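(* Let $(T,b)$ be a quadratic Bol algebra and let $(T,l,R,L)$ be its adjoint representation, where $l(x)(y)=x*y$, $R(x,y)(z)=[\![z,x,y]\!]$ and $L(x,y)(z)=[\![x,y,z]\!]$ for $x,y,z\in T$. Then $(T^*,l^*,-R^*\iota,L_{-R^*\iota})$ is a representation of the Bol algebra $T$ on the dual space $T^*$, where for $x,y\in T$ and $f\in T^*$ $$l^*(x)(f)=-f\circ l(x),\qquad (-R^*\iota)(x,y)(f)=f\circ R(y,x),\qquad L_{-R^*\iota}(x,y)(f)=-f\circ L(x,y).$$
   Context: All vector spaces are finite-dimensional over $\mathbb{R}$. A (left) Bol algebra is a triple $(T,*,[\![\,,\,,\,]\!])$ consisting of a vector space $T$, a bilinear operation $*:T\times T\to T$ and a trilinear operation $[\![\,,\,,\,]\!]:T\times T\times T\to T$ such that for all $u,v,x,y,z\in T$: (T01) $x*y=-y*x$; (T02) $[\![x,y,z]\!]=-[\![y,x,z]\!]$; (T1) $[\![x,y,z]\!]+[\![y,z,x]\!]+[\![z,x,y]\!]=0$; (T2) $[\![u,v,[\![x,y,z]\!]]\!]=[\![[\![u,v,x]\!],y,z]\!]+[\![x,[\![u,v,y]\!],z]\!]+[\![x,y,[\![u,v,z]\!]]\!]$; (T3) $[\![u,v,x*y]\!]=[\![u,v,x]\!]*y+x*[\![u,v,y]\!]+[\![x,y,u*v]\!]-(x*y)*(u*v)$. A quadratic Bol algebra is a pair $(T,b)$ where $T$ is a Bol algebra and $b:T\times T\to\mathbb{R}$ is a nondegenerate symmetric bilinear form satisfying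 $b(x*y,z)=b(x,y*z)$ and either of the following two conditions (equivalent for symmetric $b$): $b([\![x,y,z]\!],u)=b([\![z,u,x]\!],y)$, or $b([\![x,y,z]\!],u)=-b(z,[\![x,y,u]\!])$, for all $x,y,z,u\in T$. A representation of a Bol algebra $T$ is a quadruple $(V,\rho,\theta,D_\theta)$ with $V$ a vector space, $\rho:T\to \mathrm{End}(V)$ linear, and $\theta,D_\theta:T\times T\to\mathrm{End}(V)$ bilinear, such that for all $u,v,x,y,z\in T$ (with $[A,B]=AB-BA$ in $\mathrm{End}(V)$): (R1) $D_\theta(x,y)+\theta(x,y)-\theta(y,x)=0$; (R21) $[D_\theta(x,y),\rho(z)]=\rho([\![x,y,z]\!])+\rho(x*y)\rho(z)-\theta(z,x*y)$; (R22) $\theta(x,y*z)=\rho(y)\theta(x,z)-\rho(z)\theta(x,y)-(D_\theta(y,z)-\rho(y*z))\rho(x)$; (R31) $[D_\theta(u,v),D_\theta(x,y)]=D_\theta([\![u,v,x]\!],y)+D_\theta(x,[\![u,v,y]\!])$; (R32) $[D_\theta(u,v),\theta(x,y)]=\theta([\![u,v,x]\!],y)+\theta(x,[\![u,v,y]\!])$; (R33) $\theta(u,[\![x,y,z]\!])=\theta(y,z)\theta(u,x)-\theta(x,z)\theta(u,y)+D_\theta(x,y)\theta(u,z)$. The quadruple $(T,l,R,L)$ is a representation of $T$, called the adjoint representation. The quadruple $(T^*,l^*,-R^*\iota,L_{-R^*\iota})$ is called the coadjoint representation ($\iota$ denotes the switching of the two arguments). *)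

theory Defs
  imports "HOL-Analysis.Linear_Algebra"
begin

section \<open>Finite dimension and multilinear maps\<close>

definition finite_dim :: "'a::real_vector itself \<Rightarrow> bool" where
  "finite_dim _ \<longleftrightarrow>
     (\<exists>B::'a set. finite_dimensional_vector_space ((*\<^sub>R) :: real \<Rightarrow> 'a \<Rightarrow> 'a) B)"

definition trilinear ::
  "('a::real_vector \<Rightarrow> 'b::real_vector \<Rightarrow> 'c::real_vector \<Rightarrow> 'd::real_vector) \<Rightarrow> bool" where
  "trilinear f \<longleftrightarrow>
     (\<forall>y z. linear (\<lambda>x. f x y z)) \<and>
     (\<forall>x z. linear (\<lambda>y. f x y z)) \<and>
     (\<forall>x y. linear (\<lambda>z. f x y z))"


section \<open>The dual space\<close>

typedef (overloaded) 'a dual_space = "{f :: 'a::real_vector \<Rightarrow> real. linear f}"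
  morphisms dual_apply Dual
  using linear_zero by blast

setup_lifting type_definition_dual_space

instantiation dual_space :: (real_vector) real_vector
begin

lift_definition zero_dual_space :: "'a dual_space" is "\<lambda>x. 0"
  by (rule linear_zero)

lift_definition plus_dual_space :: "'a dual_space \<Rightarrow> 'a dual_space \<Rightarrow> 'a dual_space"
  is "\<lambda>f g x. f x + g x"
  by (rule linear_compose_add)

lift_definition minus_dual_space :: "'a dual_space \<Rightarrow> 'a dual_space \<Rightarrow> 'a dual_space"
  is "\<lambda>f g x. f x - g x"
  by (rule linear_compose_sub)

lift_definition uminus_dual_space :: "'a dual_space \<Rightarrow> 'a dual_space"
  is "\<lambda>f x. - f x"
  by (rule linear_compose_neg)

lift_definition scaleR_dual_space :: "real \<Rightarrow> 'a dual_space \<Rightarrow> 'a dual_space"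
  is "\<lambda>c f x. c *\<^sub>R f x"
  by (rule linear_compose_scale_right)

instance
  by standard (transfer; simp add: algebra_simps fun_eq_iff)+

end

text \<open>
  \<open>dual_comp f A\<close> is the functional \<open>f \<circ> A\<close>. As \<open>Dual\<close> is specified on linear maps only,
  it is meaningful only for linear \<open>A\<close>.
\<close>

definition dual_comp :: "'a::real_vector dual_space \<Rightarrow> ('a \<Rightarrow> 'a) \<Rightarrow> 'a dual_space" where
  "dual_comp f A = Dual (dual_apply f \<circ> A)"

lemma dual_apply_dual_comp:
  assumes "linear A"
  shows "dual_apply (dual_comp f A) x = dual_apply f (A x)"
  using linear_compose[OF assms, of "dual_apply f"] dual_apply[of f]
  by (simp add: dual_comp_def Dual_inverse o_def)


section \<open>Bol algebras\<close>

locale bol_algebra =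
  fixes mult :: "'t::real_vector \<Rightarrow> 't \<Rightarrow> 't" (infixl \<open>\<star>\<close> 70)
    and br :: "'t \<Rightarrow> 't \<Rightarrow> 't \<Rightarrow> 't" (\<open>\<lbrace>_, _, _\<rbrace>\<close>)
  assumes finite_dim: "finite_dim TYPE('t)"
    and bilinear_mult: "bilinear (\<star>)"
    and trilinear_br: "trilinear br"
    and T01: "x \<star> y = - (y \<star> x)"
    and T02: "\<lbrace>x, y, z\<rbrace> = - \<lbrace>y, x, z\<rbrace>"
    and T1: "\<lbrace>x, y, z\<rbrace> + \<lbrace>y, z, x\<rbrace> + \<lbrace>z, x, y\<rbrace> = 0"
    and T2: "\<lbrace>u, v, \<lbrace>x, y, z\<rbrace>\<rbrace> =
               \<lbrace>\<lbrace>u, v, x\<rbrace>, y, z\<rbrace> + \<lbrace>x, \<lbrace>u, v, y\<rbrace>, z\<rbrace> + \<lbrace>x, y, \<lbrace>u, v, z\<rbrace>\<rbrace>"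
    and T3: "\<lbrace>u, v, x \<star> y\<rbrace> =
               \<lbrace>u, v, x\<rbrace> \<star> y + x \<star> \<lbrace>u, v, y\<rbrace> + \<lbrace>x, y, u \<star> v\<rbrace> - (x \<star> y) \<star> (u \<star> v)"

locale quadratic_bol_algebra = bol_algebra mult br
  for mult :: "'t::real_vector \<Rightarrow> 't \<Rightarrow> 't" (infixl \<open>\<star>\<close> 70)
    and br :: "'t \<Rightarrow> 't \<Rightarrow> 't \<Rightarrow> 't" (\<open>\<lbrace>_, _, _\<rbrace>\<close>) +
  fixes b :: "'t \<Rightarrow> 't \<Rightarrow> real"
  assumes bilinear_form: "bilinear b"
    and symmetric: "b x y = b y x"
    and nondegenerate: "(\<And>y. b x y = 0) \<Longrightarrow> x = 0"
    and invariant_mult: "b (x \<star> y) z = b x (y \<star> z)"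
    and invariant_br:
      "(\<forall>x y z u. b \<lbrace>x, y, z\<rbrace> u = b \<lbrace>z, u, x\<rbrace> y) \<or>
       (\<forall>x y z u. b \<lbrace>x, y, z\<rbrace> u = - b z \<lbrace>x, y, u\<rbrace>)"


section \<open>Representations\<close>

text \<open>
  Functions carry no real vector space structure in the library, so linearity into
  \<open>End(V)\<close> and identities in \<open>End(V)\<close> are stated pointwise at \<open>w :: 'v\<close>.
\<close>

definition commutator :: "('v::real_vector \<Rightarrow> 'v) \<Rightarrow> ('v \<Rightarrow> 'v) \<Rightarrow> 'v \<Rightarrow> 'v" where
  "commutator A B = (\<lambda>w. A (B w) - B (A w))"

locale bol_representation = bol_algebra mult br
  for mult :: "'t::real_vector \<Rightarrow> 't \<Rightarrow> 't" (infixl \<open>\<star>\<close> 70)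
    and br :: "'t \<Rightarrow> 't \<Rightarrow> 't \<Rightarrow> 't" (\<open>\<lbrace>_, _, _\<rbrace>\<close>) +
  fixes \<rho> :: "'t \<Rightarrow> 'v::real_vector \<Rightarrow> 'v"
    and \<theta> :: "'t \<Rightarrow> 't \<Rightarrow> 'v \<Rightarrow> 'v"
    and D :: "'t \<Rightarrow> 't \<Rightarrow> 'v \<Rightarrow> 'v"
  assumes finite_dim_rep: "finite_dim TYPE('v)"
    and rho_End: "linear (\<rho> x)"
    and theta_End: "linear (\<theta> x y)"
    and D_End: "linear (D x y)"
    and linear_rho: "linear (\<lambda>x. \<rho> x w)"
    and bilinear_theta: "bilinear (\<lambda>x y. \<theta> x y w)"
    and bilinear_D: "bilinear (\<lambda>x y. D x y w)"
    and R1: "D x y w + \<theta> x y w - \<theta> y x w = 0"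
    and R21: "commutator (D x y) (\<rho> z) w =
                \<rho> \<lbrace>x, y, z\<rbrace> w + \<rho> (x \<star> y) (\<rho> z w) - \<theta> z (x \<star> y) w"
    and R22: "\<theta> x (y \<star> z) w =
                \<rho> y (\<theta> x z w) - \<rho> z (\<theta> x y w) - (D y z (\<rho> x w) - \<rho> (y \<star> z) (\<rho> x w))"
    and R31: "commutator (D u v) (D x y) w = D \<lbrace>u, v, x\<rbrace> y w + D x \<lbrace>u, v, y\<rbrace> w"
    and R32: "commutator (D u v) (\<theta> x y) w = \<theta> \<lbrace>u, v, x\<rbrace> y w + \<theta> x \<lbrace>u, v, y\<rbrace> w"
    and R33: "\<theta> u \<lbrace>x, y, z\<rbrace> w =
                \<theta> y z (\<theta> u x w) - \<theta> x z (\<theta> u y w) + D x y (\<theta> u z w)"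


section \<open>Adjoint and coadjoint operators\<close>

definition adj_l :: "('t \<Rightarrow> 't \<Rightarrow> 't) \<Rightarrow> 't \<Rightarrow> 't \<Rightarrow> 't" where
  "adj_l mult x = (\<lambda>y. mult x y)"

definition adj_R :: "('t \<Rightarrow> 't \<Rightarrow> 't \<Rightarrow> 't) \<Rightarrow> 't \<Rightarrow> 't \<Rightarrow> 't \<Rightarrow> 't" where
  "adj_R br x y = (\<lambda>z. br z x y)"

definition adj_L :: "('t \<Rightarrow> 't \<Rightarrow> 't \<Rightarrow> 't) \<Rightarrow> 't \<Rightarrow> 't \<Rightarrow> 't \<Rightarrow> 't" where
  "adj_L br x y = (\<lambda>z. br x y z)"

text \<open>\<open>l\<^sup>*\<close>, \<open>-R\<^sup>*\<iota>\<close> (note the switched arguments) and \<open>L\<close> with index \<open>-R\<^sup>*\<iota>\<close>.\<close>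

definition coadj_l ::
  "('t::real_vector \<Rightarrow> 't \<Rightarrow> 't) \<Rightarrow> 't \<Rightarrow> 't dual_space \<Rightarrow> 't dual_space" where
  "coadj_l mult x f = - dual_comp f (adj_l mult x)"

definition coadj_R ::
  "('t::real_vector \<Rightarrow> 't \<Rightarrow> 't \<Rightarrow> 't) \<Rightarrow> 't \<Rightarrow> 't \<Rightarrow> 't dual_space \<Rightarrow> 't dual_space" where
  "coadj_R br x y f = dual_comp f (adj_R br y x)"

definition coadj_L ::
  "('t::real_vector \<Rightarrow> 't \<Rightarrow> 't \<Rightarrow> 't) \<Rightarrow> 't \<Rightarrow> 't \<Rightarrow> 't dual_space \<Rightarrow> 't dual_space" where
  "coadj_L br x y f = - dual_comp f (adj_L br x y)"

end

theory Submission
  imports Defs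
begin

text \<open>
  A representation can be pushed forward along any surjective linear map that intertwines its
  operators with given operators on the target: every axiom is an equation between values of
  these operators, linear in them, and every vector of the target is an image. The coadjoint
  representation arises from the adjoint one in this way. The map is \<open>w \<mapsto> b w\<close>, the
  musical isomorphism \<open>T \<rightarrow> T\<^sup>*\<close> of the invariant form \<open>b\<close>, which is onto because
  \<open>b\<close> is nondegenerate and \<open>T\<close> is finite-dimensional.

  That it intertwines is what invariance says. For \<open>l\<close> and \<open>l\<^sup>*\<close> this is associativity of
  \<open>b\<close> together with \<open>T01\<close>. For the ternary operators, \<open>b \<lbrace>x, y, z\<rbrace> u\<close> has the symmetries
  of a Riemann curvature tensor: it is skew in \<open>x, y\<close>, satisfies the Bianchi identity
  \<open>T1\<close>, and is invariant under exchange of the two pairs or skew in \<open>z, u\<close>, two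
  conditions that imply each other. Skewness in \<open>z, u\<close> gives the case of \<open>L\<close>, and the
  pair symmetry combined with both skewnesses gives the case of \<open>R\<close>.
\<close>

section \<open>Finite-dimensional spaces and their functionals\<close>

lemma dual_space_eqI: "(\<And>y. dual_apply f y = dual_apply g y) \<Longrightarrow> f = g"
  by (metis dual_apply_inject ext)

lemma finite_dim_surj_image:
  fixes \<phi> :: "'a::real_vector \<Rightarrow> 'b::real_vector"
  assumes "finite_dim TYPE('a)" "linear \<phi>" "surj \<phi>"
  shows "finite_dim TYPE('b)"
proof -
  obtain B :: "'a set" where "finite_dimensional_vector_space (*\<^sub>R) B"
    using assms(1) by (auto simp: finite_dim_def)
  then interpret V: finite_dimensional_vector_space "(*\<^sub>R) :: real \<Rightarrow> 'a \<Rightarrow> 'a" B .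
  have fin: "finite B" by (rule V.finite_Basis)
  have sp: "span B = UNIV"
    using V.span_Basis by (simp add: span_raw_def)
  have "span (\<phi> ` B) = UNIV"
    using linear_span_image[OF assms(2), of B] assms(3) sp by simp
  then obtain C where C: "C \<subseteq> \<phi> ` B" "independent C" "span C = UNIV"
    using maximal_independent_subset[of "\<phi> ` B"]
    by (metis span_mono span_span top.extremum_uniqueI)
  have "finite C"
    using C(1) fin finite_subset by blast
  then have "finite_dimensional_vector_space ((*\<^sub>R) :: real \<Rightarrow> 'b \<Rightarrow> 'b) C"
    using C(2,3)
    by unfold_locales (simp_all add: dependent_raw_def span_raw_def)
  then show ?thesis
    by (auto simp: finite_dim_def)
qed

text \<open>
  Read off on a basis \<open>B\<close>, the form gives the endomorphism \<open>w \<mapsto> \<Sum>e\<in>B. b w e *\<^sub>R e\<close>.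
  It is injective by nondegeneracy, hence onto, and a preimage of \<open>\<Sum>e\<in>B. f e *\<^sub>R e\<close>
  represents the functional \<open>f\<close>. Staying inside \<open>T\<close> avoids dual bases.
\<close>

lemma nondegenerate_form_represents_functional:
  fixes b :: "'a::real_vector \<Rightarrow> 'a \<Rightarrow> real"
  assumes fd: "finite_dim TYPE('a)" and bil: "bilinear b"
    and nondeg: "\<And>x. (\<And>y. b x y = 0) \<Longrightarrow> x = 0"
    and f: "linear f"
  shows "\<exists>w. \<forall>y. b w y = f y"
proof -
  obtain B :: "'a set" where "finite_dimensional_vector_space (*\<^sub>R) B"
    using fd by (auto simp: finite_dim_def)
  then interpret V: finite_dimensional_vector_space "(*\<^sub>R) :: real \<Rightarrow> 'a \<Rightarrow> 'a" B .
  have fin: "finite B" by (rule V.finite_Basis)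
  have sp: "span B = UNIV"
    using V.span_Basis by (simp add: span_raw_def)
  have ind: "independent B"
    using V.independent_Basis by (simp add: dependent_raw_def)
  have coeffs: "g e = h e"
    if "(\<Sum>e\<in>B. g e *\<^sub>R e) = (\<Sum>e\<in>B. h e *\<^sub>R e)" "e \<in> B" for g h and e
  proof -
    have "(\<Sum>e\<in>B. (g e - h e) *\<^sub>R e) = 0"
      using that(1) by (simp add: scaleR_left_diff_distrib sum_subtractf)
    then show ?thesis
      using independentD[OF ind fin subset_refl, of "\<lambda>e. g e - h e"] that(2) by simp
  qed
  have agree: "g y = h y" if "linear g" "linear h" "\<And>e. e \<in> B \<Longrightarrow> g e = h e"
    for g h :: "'a \<Rightarrow> real" and y
    using linear_eq_on[OF that(1,2), of y B] that(3) sp by simp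
  have lin_right: "linear (b w)" for w
    using bil by (simp add: bilinear_def)
  have lin_left: "linear (\<lambda>w. b w y)" for y
    using bil by (simp add: bilinear_def)
  define \<Phi> where "\<Phi> w = (\<Sum>e\<in>B. b w e *\<^sub>R e)" for w
  have lin: "linear \<Phi>"
    unfolding \<Phi>_def
    by (rule linearI)
      (simp_all add: linear_add[OF lin_left] linear_scale[OF lin_left] scaleR_left_distrib
        sum.distrib scaleR_sum_right)
  have "w = 0" if "\<Phi> w = 0" for w
  proof (rule nondeg)
    have "b w e = 0" if "e \<in> B" for e
      using coeffs[of "b w" "\<lambda>_. 0" e] that \<open>\<Phi> w = 0\<close> by (simp add: \<Phi>_def)
    then show "b w y = 0" for y
      using agree[OF lin_right linear_zero] by blast
  qed
  then have "inj \<Phi>"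
    using linear_injective_0[OF lin] by blast
  then have "surj \<Phi>"
    using V.linear_inj_imp_surj[of \<Phi>] lin by (simp add: linear_def)
  then obtain w where "\<Phi> w = (\<Sum>e\<in>B. f e *\<^sub>R e)"
    by (metis surjD)
  then have "b w e = f e" if "e \<in> B" for e
    using coeffs[of "b w" f e] that by (simp add: \<Phi>_def)
  then show ?thesis
    using agree[OF lin_right f] by blast
qed

section \<open>Representations of Bol algebras\<close>

text \<open>
  As \<open>\<phi>\<close> is onto, the intertwining relations determine the operators on the target, so
  their linearity descends along \<open>\<phi>\<close> together with the axioms.
\<close>

lemma (in bol_representation) push_forward:
  fixes \<phi> :: "'v \<Rightarrow> 'w::real_vector"
  assumes lin: "linear \<phi>" and surj: "surj \<phi>"
    and \<rho>': "\<And>x w. \<rho>' x (\<phi> w) = \<phi> (\<rho> x w)"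
    and \<theta>': "\<And>x y w. \<theta>' x y (\<phi> w) = \<phi> (\<theta> x y w)"
    and D': "\<And>x y w. D' x y (\<phi> w) = \<phi> (D x y w)"
  shows "bol_representation mult br \<rho>' \<theta>' D'"
proof -
  note hom = linear_add[OF lin] linear_diff[OF lin] linear_scale[OF lin] linear_0[OF lin]
  have lin_comp: "linear (\<lambda>x. \<phi> (f x))" if "linear f" for f :: "'t \<Rightarrow> 'v"
    using linear_compose[OF that lin] by (simp add: o_def)
  have End: "linear A'" if "linear A" "\<And>w. A' (\<phi> w) = \<phi> (A w)"
    for A :: "'v \<Rightarrow> 'v" and A' :: "'w \<Rightarrow> 'w"
  proof (rule linearI)
    fix p q :: 'w and c :: real
    obtain v w where vw: "p = \<phi> v" "q = \<phi> w"
      using surj by (metis surjD)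
    show "A' (p + q) = A' p + A' q"
      using that(2)[of "v + w"] by (simp add: vw hom that(2) linear_add[OF that(1)])
    show "A' (c *\<^sub>R p) = c *\<^sub>R A' p"
      using that(2)[of "c *\<^sub>R v"] by (simp add: vw hom that(2) linear_scale[OF that(1)])
  qed
  show ?thesis
  proof (intro bol_representation.intro bol_representation_axioms.intro)
    show "bol_algebra (\<star>) br" by (rule bol_algebra_axioms)
    show "finite_dim TYPE('w)"
      by (rule finite_dim_surj_image[OF finite_dim_rep lin surj])
    show "linear (\<rho>' x)" for x
      by (rule End[OF rho_End \<rho>'])
    show "linear (\<theta>' x y)" for x y
      by (rule End[OF theta_End \<theta>'])
    show "linear (D' x y)" for x y
      by (rule End[OF D_End D'])
  next
    fix p
    obtain w where w: "p = \<phi> w" using surj by (metis surjD)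
    show "linear (\<lambda>x. \<rho>' x p)"
      using lin_comp[OF linear_rho] by (simp add: w \<rho>')
    show "bilinear (\<lambda>x y. \<theta>' x y p)"
      using bilinear_theta[of w] by (auto simp: bilinear_def w \<theta>' intro: lin_comp)
    show "bilinear (\<lambda>x y. D' x y p)"
      using bilinear_D[of w] by (auto simp: bilinear_def w D' intro: lin_comp)
  next
    fix u v x y z p
    obtain w where w: "p = \<phi> w" using surj by (metis surjD)
    note push = w \<rho>' \<theta>' D' commutator_def hom[symmetric]
    show "D' x y p + \<theta>' x y p - \<theta>' y x p = 0"
      using R1[of x y w] by (simp add: push)
    show "commutator (D' x y) (\<rho>' z) p =
        \<rho>' \<lbrace>x, y, z\<rbrace> p + \<rho>' (x \<star> y) (\<rho>' z p) - \<theta>' z (x \<star> y) p"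
      using R21[of x y z w] by (simp add: push)
    show "\<theta>' x (y \<star> z) p =
        \<rho>' y (\<theta>' x z p) - \<rho>' z (\<theta>' x y p) - (D' y z (\<rho>' x p) - \<rho>' (y \<star> z) (\<rho>' x p))"
      using R22[of x y z w] by (simp add: push)
    show "commutator (D' u v) (D' x y) p = D' \<lbrace>u, v, x\<rbrace> y p + D' x \<lbrace>u, v, y\<rbrace> p"
      using R31[of u v x y w] by (simp add: push)
    show "commutator (D' u v) (\<theta>' x y) p = \<theta>' \<lbrace>u, v, x\<rbrace> y p + \<theta>' x \<lbrace>u, v, y\<rbrace> p"
      using R32[of u v x y w] by (simp add: push)
    show "\<theta>' u \<lbrace>x, y, z\<rbrace> p =
        \<theta>' y z (\<theta>' u x p) - \<theta>' x z (\<theta>' u y p) + D' x y (\<theta>' u z p)"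
      using R33[of u x y z w] by (simp add: push)
  qed
qed

text \<open>
  \<open>R1\<close> is the cyclic identity \<open>T1\<close>; \<open>R21\<close> and \<open>R22\<close> are \<open>T3\<close> with the argument
  \<open>w\<close> in different places, and \<open>R31\<close>, \<open>R32\<close>, \<open>R33\<close> are likewise three readings
  of \<open>T2\<close>.
\<close>

lemma (in bol_algebra) adjoint_representation:
  "bol_representation mult br (adj_l mult) (adj_R br) (adj_L br)"
proof -
  have linm: "linear (\<lambda>y. x \<star> y)" "linear (\<lambda>y. y \<star> x)" for x
    using bilinear_mult by (simp_all add: bilinear_def)
  have linb: "linear (\<lambda>x. \<lbrace>x, y, z\<rbrace>)" "linear (\<lambda>x. \<lbrace>y, x, z\<rbrace>)" "linear (\<lambda>x. \<lbrace>y, z, x\<rbrace>)"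
    for y z
    using trilinear_br by (simp_all add: trilinear_def)
  note defs = adj_l_def adj_R_def adj_L_def commutator_def
  show ?thesis
  proof (intro bol_representation.intro bol_representation_axioms.intro)
    fix u v x y z w
    show "adj_L br x y w + adj_R br x y w - adj_R br y x w = 0"
      using T1[of x y w] T02[of w y x] by (simp add: defs algebra_simps)
    show "commutator (adj_L br x y) (adj_l (\<star>) z) w =
        adj_l (\<star>) \<lbrace>x, y, z\<rbrace> w + adj_l (\<star>) (x \<star> y) (adj_l (\<star>) z w)
          - adj_R br z (x \<star> y) w"
      using T3[of x y z w] T01[of "z \<star> w" "x \<star> y"] T02[of w z "x \<star> y"]
      by (simp add: defs algebra_simps)
    have "\<lbrace>y, z, w \<star> x\<rbrace> = - \<lbrace>y, z, x \<star> w\<rbrace>"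
      using T01[of w x] linear_neg[OF linb(3), of y z "x \<star> w"] by simp
    moreover have "(y \<star> z) \<star> (w \<star> x) = - ((y \<star> z) \<star> (x \<star> w))"
      using T01[of w x] linear_neg[OF linm(1), of "y \<star> z" "x \<star> w"] by simp
    ultimately show "adj_R br x (y \<star> z) w =
        adj_l (\<star>) y (adj_R br x z w) - adj_l (\<star>) z (adj_R br x y w)
          - (adj_L br y z (adj_l (\<star>) x w) - adj_l (\<star>) (y \<star> z) (adj_l (\<star>) x w))"
      using T3[of w x y z] T01[of "\<lbrace>w, x, y\<rbrace>" z] by (simp add: defs algebra_simps)
    show "commutator (adj_L br u v) (adj_L br x y) w =
        adj_L br \<lbrace>u, v, x\<rbrace> y w + adj_L br x \<lbrace>u, v, y\<rbrace> w"
      using T2[of u v x y w] by (simp add: defs)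
    show "commutator (adj_L br u v) (adj_R br x y) w =
        adj_R br \<lbrace>u, v, x\<rbrace> y w + adj_R br x \<lbrace>u, v, y\<rbrace> w"
      using T2[of u v w x y] by (simp add: defs)
    show "adj_R br u \<lbrace>x, y, z\<rbrace> w =
        adj_R br y z (adj_R br u x w) - adj_R br x z (adj_R br u y w)
          + adj_L br x y (adj_R br u z w)"
      using T2[of w u x y z] T02[of x "\<lbrace>w, u, y\<rbrace>" z] by (simp add: defs)
  qed (simp_all add: defs bilinear_def linm linb bol_algebra_axioms finite_dim)
qed

section \<open>The invariant form as an intertwiner\<close>

context quadratic_bol_algebra
begin

text \<open>
  The classical argument for the curvature tensor, in both directions: pair exchange carries
  skewness from the first pair to the second, and conversely the two skewnesses with the
  Bianchi identity force pair exchange. The six values of \<open>b \<lbrace>_, _, _\<rbrace> _\<close> that the two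
  skewnesses leave distinct up to sign satisfy four Bianchi identities, one for each argument
  held in the last place. Adding these with signs cancels all values but
  \<open>b \<lbrace>x, y, z\<rbrace> u\<close> and \<open>b \<lbrace>z, u, x\<rbrace> y\<close>.
\<close>

lemma skew_last_pair: "b \<lbrace>x, y, z\<rbrace> u = - b \<lbrace>x, y, u\<rbrace> z"
  and pair_exchange: "b \<lbrace>x, y, z\<rbrace> u = b \<lbrace>z, u, x\<rbrace> y"
proof -
  have lin_left: "linear (\<lambda>w. b w y)" for y
    using bilinear_form by (simp add: bilinear_def)
  have skew_first: "b \<lbrace>x, y, z\<rbrace> u = - b \<lbrace>y, x, z\<rbrace> u" for x y z u
    using T02[of x y z] linear_neg[OF lin_left] by metis
  have bianchi: "b \<lbrace>x, y, z\<rbrace> u + b \<lbrace>y, z, x\<rbrace> u + b \<lbrace>z, x, y\<rbrace> u = 0" for x y z u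
    using arg_cong[OF T1[of x y z], of "\<lambda>w. b w u"]
    by (simp add: linear_add[OF lin_left] linear_0[OF lin_left])
  have "(\<forall>x y z u. b \<lbrace>x, y, z\<rbrace> u = - b \<lbrace>x, y, u\<rbrace> z) \<and>
      (\<forall>x y z u. b \<lbrace>x, y, z\<rbrace> u = b \<lbrace>z, u, x\<rbrace> y)"
    using invariant_br
  proof
    assume exch: "\<forall>x y z u. b \<lbrace>x, y, z\<rbrace> u = b \<lbrace>z, u, x\<rbrace> y"
    then show ?thesis
      using skew_first by metis
  next
    assume "\<forall>x y z u. b \<lbrace>x, y, z\<rbrace> u = - b z \<lbrace>x, y, u\<rbrace>"
    then have skew: "b \<lbrace>x, y, z\<rbrace> u = - b \<lbrace>x, y, u\<rbrace> z" for x y z u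
      by (metis symmetric)
    have "b \<lbrace>x, y, z\<rbrace> u = b \<lbrace>z, u, x\<rbrace> y" for x y z u
      using bianchi[of x y z u] bianchi[of y z u x] bianchi[of z u x y] bianchi[of u x y z]
        skew_first[of u y z x] skew_first[of u x z y] skew_first[of x z u y]
        skew_first[of u x y z] skew[of y z u x] skew[of z u y x] skew[of x u z y]
        skew[of z x u y] skew[of x y u z] skew[of y u x z]
      by linarith
    with skew show ?thesis by blast
  qed
  then show "b \<lbrace>x, y, z\<rbrace> u = - b \<lbrace>x, y, u\<rbrace> z" "b \<lbrace>x, y, z\<rbrace> u = b \<lbrace>z, u, x\<rbrace> y"
    by blast+
qed

definition flat :: "'t \<Rightarrow> 't dual_space" where
  "flat w = Dual (b w)"

lemma dual_apply_flat: "dual_apply (flat w) y = b w y"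
  using bilinear_form by (simp add: flat_def Dual_inverse bilinear_def)

lemma linear_flat: "linear flat"
proof -
  have lin_left: "linear (\<lambda>w. b w y)" for y
    using bilinear_form by (simp add: bilinear_def)
  show ?thesis
    by (rule linearI; rule dual_space_eqI)
      (simp_all add: dual_apply_flat plus_dual_space.rep_eq scaleR_dual_space.rep_eq
        linear_add[OF lin_left] linear_scale[OF lin_left])
qed

lemma surj_flat: "surj flat"
proof (rule surjI)
  fix f
  have "\<exists>w. \<forall>y. b w y = dual_apply f y"
    using dual_apply[of f]
    by (intro nondegenerate_form_represents_functional[OF finite_dim bilinear_form nondegenerate])
      auto
  then have "\<exists>w. flat w = f"
    by (metis dual_space_eqI dual_apply_flat)
  then show "flat (SOME w. flat w = f) = f"
    by (rule someI_ex)
qed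

lemma coadj_l_flat: "coadj_l mult x (flat w) = flat (adj_l mult x w)"
proof (rule dual_space_eqI)
  fix y
  have "linear (adj_l mult x)"
    using bilinear_mult by (simp add: bilinear_def adj_l_def)
  moreover have "b (x \<star> w) y = - b w (x \<star> y)"
    using T01[of x w] invariant_mult[of w x y] bilinear_lneg[OF bilinear_form] by simp
  ultimately show "dual_apply (coadj_l mult x (flat w)) y = dual_apply (flat (adj_l mult x w)) y"
    by (simp add: coadj_l_def uminus_dual_space.rep_eq dual_apply_dual_comp dual_apply_flat
        adj_l_def)
qed

lemma coadj_L_flat: "coadj_L br x y (flat w) = flat (adj_L br x y w)"
proof (rule dual_space_eqI)
  fix z
  have "linear (adj_L br x y)"
    using trilinear_br by (simp add: trilinear_def adj_L_def)
  moreover have "b \<lbrace>x, y, w\<rbrace> z = - b w \<lbrace>x, y, z\<rbrace>"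
    using skew_last_pair symmetric by metis
  ultimately show "dual_apply (coadj_L br x y (flat w)) z = dual_apply (flat (adj_L br x y w)) z"
    by (simp add: coadj_L_def uminus_dual_space.rep_eq dual_apply_dual_comp dual_apply_flat
        adj_L_def)
qed

text \<open>
  The switch \<open>\<iota>\<close> appears because pair exchange followed by both skewnesses reverses the four
  arguments of \<open>b \<lbrace>w, x, y\<rbrace> z\<close>.
\<close>

lemma coadj_R_flat: "coadj_R br x y (flat w) = flat (adj_R br x y w)"
proof (rule dual_space_eqI)
  fix z
  have "linear (adj_R br y x)"
    using trilinear_br by (simp add: trilinear_def adj_R_def)
  moreover have "b \<lbrace>w, x, y\<rbrace> z = b w \<lbrace>z, y, x\<rbrace>"
  proof -
    have "b \<lbrace>w, x, y\<rbrace> z = b \<lbrace>y, z, w\<rbrace> x"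
      by (rule pair_exchange)
    also have "\<dots> = - b \<lbrace>y, z, x\<rbrace> w"
      by (rule skew_last_pair)
    also have "\<dots> = b \<lbrace>z, y, x\<rbrace> w"
      using T02[of y z x] bilinear_lneg[OF bilinear_form] by simp
    finally show ?thesis
      by (simp add: symmetric)
  qed
  ultimately show "dual_apply (coadj_R br x y (flat w)) z = dual_apply (flat (adj_R br x y w)) z"
    by (simp add: coadj_R_def dual_apply_dual_comp dual_apply_flat adj_R_def)
qed

end

theorem theorem3p2:
  fixes mult :: "'t::real_vector \<Rightarrow> 't \<Rightarrow> 't"
    and br :: "'t \<Rightarrow> 't \<Rightarrow> 't \<Rightarrow> 't"
    and b :: "'t \<Rightarrow> 't \<Rightarrow> real"
  assumes "quadratic_bol_algebra mult br b"
  shows "bol_representation mult br (coadj_l mult) (coadj_R br) (coadj_L br)"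
proof -
  interpret quadratic_bol_algebra mult br b by (rule assms)
  interpret adjoint: bol_representation mult br "adj_l mult" "adj_R br" "adj_L br"
    by (rule adjoint_representation)
  show ?thesis
    by (rule adjoint.push_forward[OF linear_flat surj_flat coadj_l_flat coadj_R_flat coadj_L_flat])
qed

end
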